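(* Let $\mathsf{P}$ be the set of processes of the Krivine machine with I/O. Every set $\mathcal{B}\subseteq\mathsf{P}$ of processes that is closed under weak bisimilarity (i.e. $p\in\mathcal{B}$ and $p\approx q$ imply $q\in\mathcal{B}$) is a pole.
   Context: Syntax. Terms: $t ::= x \mid \lambda x.\,t \mid t\,t \mid \mathsf{cc} \mid \mathsf{k}_\pi \mid \mathsf{r} \mid \mathsf{w1} \mid \mathsf{w0} \mid \mathsf{end}$, where $\pi$ is a stack and $\mathsf{cc},\mathsf{r},\mathsf{w0},\mathsf{w1},\mathsf{end}$ are constants. Stacks: $\pi ::= \varepsilon \mid t\cdot\pi$ with $t$ closed. Processes: $p ::= t\star\pi \mid \top$ with $t$ closed, $\pi$ a stack, and $\top$ a process constant. $\mathsf{P}$ is the set of processes. Evaluation relation $\succ$ on processes (no rule involves $\mathsf{r},\mathsf{w0},\mathsf{w1},\mathsf{end}$ in head position): - $tu\star\pi\succ t\star u\cdot\pi$; - $(\lambda x.\,t[x])\star u\cdot\pi\succ t[u]\star\pi$; - $\mathsf{cc}\star t\cdot\pi\succ t\star\mathsf{k}_\pi\cdot\pi$; - $\mathsf{k}_\pi\star t\cdot\rho\succ t\star\pi$. A pole is a set $\mathcal{B}\subseteq\mathsf{P}$ of processes that is saturated: $p\in\mathcal{B}$ and $p'\succ p$ imply $p'\in\mathcal{B}$. Labeled transition system on $\mathsf{P}$, with actions $\{\tau,\mathsf{r0},\mathsf{r1},\mathsf{r}\varepsilon,\mathsf{w0},\mathsf{w1},\mathsf{e}\}$: $p\xrightarrow{\tau}q$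 iff $p\succ q$; $\mathsf{r}\star t\cdot u\cdot v\cdot\pi\xrightarrow{\mathsf{r0}}t\star\pi$; $\mathsf{r}\star t\cdot u\cdot v\cdot\pi\xrightarrow{\mathsf{r1}}u\star\pi$; $\mathsf{r}\star t\cdot u\cdot v\cdot\pi\xrightarrow{\mathsf{r}\varepsilon}v\star\pi$; $\mathsf{w0}\star t\cdot\pi\xrightarrow{\mathsf{w0}}t\star\pi$; $\mathsf{w1}\star t\cdot\pi\xrightarrow{\mathsf{w1}}t\star\pi$; $\mathsf{end}\star\pi\xrightarrow{\mathsf{e}}\top$. There are no other transitions. Write $p\Rightarrow^{\tau}q$ for the reflexive-transitive closure of $\xrightarrow{\tau}$, and for $\alpha\neq\tau$ write $p\Rightarrow^{\alpha}q$ if there are $p',q'$ with $p\Rightarrow^{\tau}p'\xrightarrow{\alpha}q'\Rightarrow^{\tau}q$. A weak bisimulation is a relation $R\subseteq\mathsf{P}^2$ such that for all actions $\alpha$ and $(p,q)\in R$: if $p\xrightarrow{\alpha}p'$ then there is $q'$ with $q\Rightarrow^{\alpha}q'$ and $(p',q')\in R$; and if $q\xrightarrow{\alpha}q'$ then there is $p'$ with $p\Rightarrow^{\alpha}p'$ and $(p',q')\in R$. Processes $p,q$ are weakly bisimilar, $p\approx q$, if $(p,q)\in R$ for some weak bisimulation $R$. *)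

theory Defs
  imports Main
begin

text \<open>
  Terms are represented with de Bruijn indices, so \<open>\<alpha>\<close>-equivalent terms are equal.
  A stack is the list of its entries, with the empty stack \<open>[]\<close> and \<open>t # \<pi>\<close> for \<open>t \<cdot> \<pi>\<close>.
  These datatypes do not enforce that stack entries and the heads of processes are closed;
  the sets \<open>stacks\<close> and \<open>processes\<close> below single out the actual stacks and processes.
\<close>

datatype tm =
    Var nat
  | Lam tm
  | App tm tm
  | CC
  | Kont "tm list"
  | Read
  | Write1
  | Write0
  | End

type_synonym stack = "tm list"

datatype process =
    Proc tm stack  (infix "\<star>" 60)
  | Top

text \<open>
  \<open>scoped n t\<close>: the term \<open>t\<close> is well-formed and its free indices are below \<open>n\<close>.  A continuation
  constant contains only closed terms, regardless of the binders around it.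
\<close>

fun scoped :: "nat \<Rightarrow> tm \<Rightarrow> bool" where
  "scoped n (Var i) \<longleftrightarrow> i < n"
| "scoped n (Lam t) \<longleftrightarrow> scoped (Suc n) t"
| "scoped n (App t u) \<longleftrightarrow> scoped n t \<and> scoped n u"
| "scoped n (Kont \<pi>) \<longleftrightarrow> (\<forall>t\<in>set \<pi>. scoped 0 t)"
| "scoped n CC \<longleftrightarrow> True"
| "scoped n Read \<longleftrightarrow> True"
| "scoped n Write1 \<longleftrightarrow> True"
| "scoped n Write0 \<longleftrightarrow> True"
| "scoped n End \<longleftrightarrow> True"

definition closed_tms :: "tm set" where
  "closed_tms = {t. scoped 0 t}"

definition stacks :: "stack set" where
  "stacks = lists closed_tms"

definition processes :: "process set" where
  "processes = {t \<star> \<pi> | t \<pi>. t \<in> closed_tms \<and> \<pi> \<in> stacks} \<union> {Top}"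

text \<open>
  \<open>subst k u t\<close> replaces index \<open>k\<close> in \<open>t\<close> by \<open>u\<close> and removes the binder it refers to.  The machine
  substitutes only closed terms \<open>u\<close>, so \<open>u\<close> is not lifted under binders; and the stack of a
  continuation constant has no free variables, so substitution does not enter it.
\<close>

primrec subst :: "nat \<Rightarrow> tm \<Rightarrow> tm \<Rightarrow> tm" where
  "subst k u (Var i) = (if i < k then Var i else if i = k then u else Var (i - 1))"
| "subst k u (Lam t) = Lam (subst (Suc k) u t)"
| "subst k u (App t t') = App (subst k u t) (subst k u t')"
| "subst k u (Kont \<pi>) = Kont \<pi>"
| "subst k u CC = CC"
| "subst k u Read = Read"
| "subst k u Write1 = Write1"
| "subst k u Write0 = Write0"
| "subst k u End = End"

inductive eval :: "process \<Rightarrow> process \<Rightarrow> bool"  (infix "\<succ>" 50) where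
  push:    "App t u \<star> \<pi> \<succ> t \<star> (u # \<pi>)"
| grab:    "Lam t \<star> (u # \<pi>) \<succ> subst 0 u t \<star> \<pi>"
| save:    "CC \<star> (t # \<pi>) \<succ> t \<star> (Kont \<pi> # \<pi>)"
| restore: "Kont \<pi> \<star> (t # \<rho>) \<succ> t \<star> \<pi>"

definition pole :: "process set \<Rightarrow> bool" where
  "pole B \<longleftrightarrow> B \<subseteq> processes \<and> (\<forall>p\<in>B. \<forall>p'\<in>processes. p' \<succ> p \<longrightarrow> p' \<in> B)"

datatype action = Tau | R0 | R1 | REps | W0 | W1 | Exit

inductive lts :: "process \<Rightarrow> action \<Rightarrow> process \<Rightarrow> bool" where
  tau:    "p \<succ> q \<Longrightarrow> lts p Tau q"
| read0:  "lts (Read \<star> (t # u # v # \<pi>)) R0 (t \<star> \<pi>)"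
| read1:  "lts (Read \<star> (t # u # v # \<pi>)) R1 (u \<star> \<pi>)"
| readE:  "lts (Read \<star> (t # u # v # \<pi>)) REps (v \<star> \<pi>)"
| write0: "lts (Write0 \<star> (t # \<pi>)) W0 (t \<star> \<pi>)"
| write1: "lts (Write1 \<star> (t # \<pi>)) W1 (t \<star> \<pi>)"
| exit:   "lts (End \<star> \<pi>) Exit Top"

definition taus :: "process \<Rightarrow> process \<Rightarrow> bool" where
  "taus = (\<lambda>p q. lts p Tau q)\<^sup>*\<^sup>*"

definition weak_lts :: "process \<Rightarrow> action \<Rightarrow> process \<Rightarrow> bool" where
  "weak_lts p \<alpha> q \<longleftrightarrow>
     (if \<alpha> = Tau then taus p q
      else \<exists>p' q'. taus p p' \<and> lts p' \<alpha> q' \<and> taus q' q)"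

definition weak_bisimulation :: "(process \<times> process) set \<Rightarrow> bool" where
  "weak_bisimulation R \<longleftrightarrow> R \<subseteq> processes \<times> processes \<and>
     (\<forall>\<alpha>. \<forall>(p, q)\<in>R.
        (\<forall>p'. lts p \<alpha> p' \<longrightarrow> (\<exists>q'. weak_lts q \<alpha> q' \<and> (p', q') \<in> R)) \<and>
        (\<forall>q'. lts q \<alpha> q' \<longrightarrow> (\<exists>p'. weak_lts p \<alpha> p' \<and> (p', q') \<in> R)))"

definition weakly_bisimilar :: "process \<Rightarrow> process \<Rightarrow> bool"  (infix "\<approx>" 50) where
  "p \<approx> q \<longleftrightarrow> (\<exists>R. weak_bisimulation R \<and> (p, q) \<in> R)"

text \<open>
  The transition relation is defined on raw processes, but it never leaves \<open>processes\<close>, so on that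
  set it is the intended labeled transition system.
\<close>

lemma scoped_mono: "scoped m t \<Longrightarrow> m \<le> n \<Longrightarrow> scoped n t"
  by (induction m t arbitrary: n rule: scoped.induct) auto

lemma scoped_subst:
  "scoped (Suc n) t \<Longrightarrow> k \<le> n \<Longrightarrow> scoped 0 u \<Longrightarrow> scoped n (subst k u t)"
proof (induction t arbitrary: n k)
  case (Var i)
  then show ?case using scoped_mono[of 0 u n] by auto
qed auto

lemma eval_processes: "p \<succ> q \<Longrightarrow> p \<in> processes \<Longrightarrow> q \<in> processes"
  by (induction rule: eval.induct)
    (auto simp: processes_def stacks_def closed_tms_def scoped_subst)

lemma lts_processes: "lts p \<alpha> q \<Longrightarrow> p \<in> processes \<Longrightarrow> q \<in> processes"
  by (induction rule: lts.induct)
    (auto simp: eval_processes, auto simp: processes_def stacks_def closed_tms_def)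

end

theory Submission
  imports Defs
begin

text \<open>
  Evaluation is deterministic, and an evaluating process has no observable action, because the
  constants that trigger those are inert under \<open>\<succ>\<close>. So if \<open>p' \<succ> p\<close>, this step is the only
  transition of \<open>p'\<close>: the process \<open>p\<close> matches it by staying where it is, while \<open>p'\<close> matches any
  transition of \<open>p\<close> by first evaluating to \<open>p\<close>. After either exchange the two sides coincide, so
  the identity together with the pair \<open>(p, p')\<close> is a weak bisimulation. Hence evaluation is
  contained in weak bisimilarity, and closure under the latter gives saturation.
\<close>

lemma lts_of_evaluating_process:
  assumes "p \<succ> q" and "lts p \<alpha> r"
  shows "\<alpha> = Tau \<and> r = q"
  using assms by (auto elim!: eval.cases lts.cases)

lemma taus_refl: "taus p p"
  by (simp add: taus_def)

lemma lts_imp_weak_lts: "lts p \<alpha> q \<Longrightarrow> weak_lts p \<alpha> q"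
  by (auto simp: weak_lts_def taus_def)

lemma weak_lts_eval_lts:
  assumes "p' \<succ> p" and "lts p \<alpha> q"
  shows "weak_lts p' \<alpha> q"
proof -
  have step: "lts p' Tau p"
    using assms(1) by (rule lts.tau)
  then have "taus p' p"
    unfolding taus_def by (rule r_into_rtranclp)
  moreover have "taus p' q" if "\<alpha> = Tau"
    using step assms(2) that by (auto simp: taus_def intro: converse_rtranclp_into_rtranclp)
  ultimately show ?thesis
    using assms(2) taus_refl by (auto simp: weak_lts_def)
qed

text \<open>
  The pair points from the reduct to the process that evaluates to it, the direction in which
  saturation propagates membership.
\<close>

lemma eval_imp_weakly_bisimilar:
  assumes "p' \<succ> p" and "p' \<in> processes"
  shows "p \<approx> p'"
proof -
  let ?R = "insert (p, p') (Id_on processes)"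
  have p: "p \<in> processes"
    using assms by (rule eval_processes)
  have identical: "(\<forall>r. lts q \<alpha> r \<longrightarrow> (\<exists>s. weak_lts q \<alpha> s \<and> (r, s) \<in> ?R)) \<and>
      (\<forall>s. lts q \<alpha> s \<longrightarrow> (\<exists>r. weak_lts q \<alpha> r \<and> (r, s) \<in> ?R))"
    if "q \<in> processes" for q \<alpha>
    using that by (blast intro: lts_imp_weak_lts lts_processes)
  have reduct: "\<exists>s. weak_lts p' \<alpha> s \<and> (r, s) \<in> ?R" if "lts p \<alpha> r" for \<alpha> r
    using weak_lts_eval_lts[OF assms(1) that] lts_processes[OF that p] by blast
  have source: "\<exists>r. weak_lts p \<alpha> r \<and> (r, s) \<in> ?R" if "lts p' \<alpha> s" for \<alpha> s
  proof -
    have "\<alpha> = Tau" "s = p"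
      using lts_of_evaluating_process[OF assms(1) that] by auto
    then show ?thesis
      using p taus_refl by (auto simp: weak_lts_def)
  qed
  have "?R \<subseteq> processes \<times> processes"
    using p assms(2) by auto
  then have "weak_bisimulation ?R"
    unfolding weak_bisimulation_def
  proof (intro conjI allI ballI)
    fix \<alpha> x
    assume "x \<in> ?R"
    then consider "x = (p, p')" | q where "q \<in> processes" "x = (q, q)"
      by auto
    then show "case x of (q, q') \<Rightarrow>
        (\<forall>r. lts q \<alpha> r \<longrightarrow> (\<exists>s. weak_lts q' \<alpha> s \<and> (r, s) \<in> ?R)) \<and>
        (\<forall>s. lts q' \<alpha> s \<longrightarrow> (\<exists>r. weak_lts q \<alpha> r \<and> (r, s) \<in> ?R))"
    proof cases
      case 1
      show ?thesis
        unfolding 1 prod.case using reduct source by (intro conjI allI impI)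
    next
      case 2
      show ?thesis
        unfolding 2(2) prod.case using 2(1) by (rule identical)
    qed
  qed
  then show ?thesis
    unfolding weakly_bisimilar_def by blast
qed

theorem lemma27:
  fixes B :: "process set"
  assumes "B \<subseteq> processes"
    and "\<And>p q. p \<in> B \<Longrightarrow> p \<approx> q \<Longrightarrow> q \<in> B"
  shows "pole B"
  unfolding pole_def using assms eval_imp_weakly_bisimilar by blast

end
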